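(* A finite simple graph $\Gamma$ yields a binary even LCD code if and only if all of the following hold: every vertex of $\Gamma$ has even degree; any two adjacent vertices have an odd number of common neighbours; and any two distinct non-adjacent vertices have an even number of common neighbours.
   Context: A binary code of length $n$ is a linear subspace $C\subseteq\mathbb{F}_2^n$ (the zero code is allowed). Its dual $C^\perp$ is taken with respect to $\langle x,y\rangle=\sum_i x_iy_i$. $C$ is LCD (linear complementary dual) if $C\cap C^\perp=\{0\}$, equivalently $\mathbb{F}_2^n=C\oplus C^\perp$. $C$ is even if every codeword has even Hamming weight. For an LCD code $C$, the orthogonal projector $\Pi_C$ is the unique $n\times n$ matrix over $\mathbb{F}_2$ with $v\Pi_C=v$ for all row vectors $v\in C$ and $v\Pi_C=0$ for all $v\in C^\perp$. A finite simple graph on $n$ (ordered) vertices with adjacency matrix $A$ is said to yield a binary even LCD code if $A$, read over $\mathbb{F}_2$, equals $\Pi_C$ for some binary even LCD code $C$ of length $n$; this $C$ (which is the row span of $A$ over $\mathbb{F}_2$) is the code yielded by the graph. *)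

theory Defs
  imports "HOL-Library.Z2" "Jordan_Normal_Form.VS_Connect"
begin

subsection \<open>Binary codes\<close>

text \<open>
  The field with two elements is the type \<^typ>\<open>bit\<close>. The zero code and the length \<open>n = 0\<close> are
  allowed.
\<close>

definition binary_code :: "nat \<Rightarrow> bit vec set \<Rightarrow> bool" where
  "binary_code n C \<longleftrightarrow> VectorSpace.subspace class_ring C (module_vec TYPE(bit) n)"

abbreviation dual_code :: "nat \<Rightarrow> bit vec set \<Rightarrow> bit vec set" where
  "dual_code n C \<equiv> vec_module.orthogonal_complement n C"

definition lcd :: "nat \<Rightarrow> bit vec set \<Rightarrow> bool" where
  "lcd n C \<longleftrightarrow> C \<inter> dual_code n C = {0\<^sub>v n}"

definition hamming_weight :: "bit vec \<Rightarrow> nat" where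
  "hamming_weight v = card {i. i < dim_vec v \<and> v $ i \<noteq> 0}"

definition even_code :: "bit vec set \<Rightarrow> bool" where
  "even_code C \<longleftrightarrow> (\<forall>v\<in>C. even (hamming_weight v))"

text \<open>
  Matrices act on row vectors from the right. The description below determines a unique matrix
  whenever \<open>C\<close> is an LCD code of length \<open>n\<close>; for other \<open>C\<close> the value is not meaningful.
\<close>

definition orthogonal_projector :: "nat \<Rightarrow> bit vec set \<Rightarrow> bit mat" where
  "orthogonal_projector n C =
     (THE P. P \<in> carrier_mat n n \<and>
        (\<forall>v\<in>C. mat_of_row v * P = mat_of_row v) \<and>
        (\<forall>v\<in>dual_code n C. mat_of_row v * P = 0\<^sub>m 1 n))"

subsection \<open>Graphs\<close>

text \<open>
  A graph on the ordered vertices \<open>0, \<dots>, n - 1\<close> is given by its set of edges, which are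
  unordered pairs of distinct vertices.
\<close>

definition simple_graph :: "nat \<Rightarrow> nat set set \<Rightarrow> bool" where
  "simple_graph n E \<longleftrightarrow> (\<forall>e\<in>E. e \<subseteq> {..<n} \<and> card e = 2)"

definition neighbours :: "nat set set \<Rightarrow> nat \<Rightarrow> nat set" where
  "neighbours E v = {w. {v, w} \<in> E}"

definition vertex_degree :: "nat set set \<Rightarrow> nat \<Rightarrow> nat" where
  "vertex_degree E v = card (neighbours E v)"

definition adjacency_matrix :: "nat \<Rightarrow> nat set set \<Rightarrow> 'a::zero_neq_one mat" where
  "adjacency_matrix n E = mat n n (\<lambda>(i, j). of_bool ({i, j} \<in> E))"

definition yields_even_lcd_code :: "nat \<Rightarrow> nat set set \<Rightarrow> bool" where
  "yields_even_lcd_code n E \<longleftrightarrow>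
     (\<exists>C. binary_code n C \<and> lcd n C \<and> even_code C \<and>
          adjacency_matrix n E = orthogonal_projector n C)"

end

theory Submission
  imports Defs
begin

text \<open>
  Over the field with two elements, the three graph conditions together say exactly that the
  adjacency matrix \<open>A\<close> is idempotent, because the entries of \<open>A\<^sup>2\<close> count common neighbours modulo 2.
  An orthogonal projector is idempotent. Conversely, a symmetric idempotent \<open>A\<close> is the orthogonal
  projector of its column space \<open>C\<close>, whose dual is the kernel of \<open>A\<close>; since all degrees are even, the
  columns have even weight, and hence so do all words of \<open>C\<close>. That an LCD code splits the
  ambient space follows from \<open>|C| |C\<^sup>\<bottom>| = 2\<^sup>n\<close>, which is obtained by summing the
  characters \<open>(-1)\<^bsup>\<langle>x,c\<rangle>\<^esup>\<close> over all \<open>x\<close> and all \<open>c \<in> C\<close> in both orders.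
\<close>

subsection \<open>Subspaces of binary vectors\<close>

lemma sum_bit_indicator:
  assumes "finite A"
  shows "(\<Sum>x\<in>A. if P x then 1 else 0) = (of_bool (odd (card {x \<in> A. P x})) :: bit)"
proof -
  have "(\<Sum>x\<in>A. if P x then 1 else 0) = (of_nat (card {x \<in> A. P x}) :: bit)"
    using assms by (subst sum.inter_filter[symmetric]) simp_all
  then show ?thesis
    by (cases "even (card {x \<in> A. P x})") (auto elim!: evenE oddE)
qed

text \<open>The only scalars are 0 and 1, so closure under scaling follows from the zero vector
  lying in \<open>C\<close>.\<close>

lemma binary_code_iff:
  "binary_code n C \<longleftrightarrow>
     C \<subseteq> carrier_vec n \<and> 0\<^sub>v n \<in> C \<and> (\<forall>x\<in>C. \<forall>y\<in>C. x + y \<in> C)"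
proof -
  interpret vec_space "TYPE(bit)" n .
  have smult: "c \<cdot>\<^sub>v x \<in> C" if "C \<subseteq> carrier_vec n" "0\<^sub>v n \<in> C" "x \<in> C" for c :: bit and x
  proof (cases "c = 0")
    case True
    moreover have "0 \<cdot>\<^sub>v x = 0\<^sub>v n"
      using that by (auto intro!: eq_vecI)
    ultimately show ?thesis
      using that by simp
  qed (use that in simp)
  show ?thesis
    unfolding binary_code_def subspace_def submodule_def
    using smult vectorspace_axioms module_axioms by auto
qed

lemma binary_codeD:
  assumes "binary_code n C"
  shows binary_code_carrier: "x \<in> C \<Longrightarrow> x \<in> carrier_vec n"
    and binary_code_zero: "0\<^sub>v n \<in> C"
    and binary_code_add: "x \<in> C \<Longrightarrow> y \<in> C \<Longrightarrow> x + y \<in> C"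
  using assms by (auto simp: binary_code_iff)

lemma dual_code_iff:
  "x \<in> dual_code n C \<longleftrightarrow> x \<in> carrier_vec n \<and> (\<forall>y\<in>C. x \<bullet> y = 0)"
  by (simp add: vec_module.orthogonal_complement_def)

lemma binary_code_dual:
  assumes "binary_code n C"
  shows "binary_code n (dual_code n C)"
  using binary_codeD[OF assms]
  by (auto simp: binary_code_iff dual_code_iff add_scalar_prod_distrib[where n = n])

text \<open>\<open>M *\<^sub>v x\<close> lies in the span of the columns of \<open>M\<close>, and a
  subspace containing the columns contains their span.\<close>

lemma binary_code_mult_mat_vec:
  assumes C: "binary_code n C" and M: "M \<in> carrier_mat n m"
    and cols: "\<And>i. i < m \<Longrightarrow> col M i \<in> C" and x: "x \<in> carrier_vec m"
  shows "M *\<^sub>v x \<in> C"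
proof -
  interpret vec_space "TYPE(bit)" n .
  have "M *\<^sub>v x \<in> col_space M"
    using M x by (auto simp: col_space_eq[OF M])
  moreover have "set (cols M) \<subseteq> C"
    using cols M by (auto simp: cols_def)
  ultimately show ?thesis
    using span_is_subset[of "set (cols M)" C] C
    by (auto simp: col_space_def binary_code_def subspace_def)
qed

lemma bit_vec_add_self:
  fixes x :: "bit vec"
  assumes "x \<in> carrier_vec n"
  shows "x + x = 0\<^sub>v n"
  using assms by (auto intro!: eq_vecI)

lemma bit_vec_add_eq_zero_iff:
  fixes x y :: "bit vec"
  assumes "x \<in> carrier_vec n" "y \<in> carrier_vec n"
  shows "x + y = 0\<^sub>v n \<longleftrightarrow> x = y"
proof
  assume "x + y = 0\<^sub>v n"
  then have "(x + y) $ i = 0" if "i < n" for i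
    using that by simp
  then have "x $ i = y $ i" if "i < n" for i
    using that assms by (cases "x $ i"; cases "y $ i") fastforce+
  then show "x = y"
    using assms by auto
qed (use assms in \<open>simp add: bit_vec_add_self\<close>)

lemma finite_carrier_vec_bit: "finite (carrier_vec n :: bit vec set)"
proof -
  have "finite (UNIV :: bit set)"
    by (rule finite_subset[of _ "{0, 1}"]) (auto intro: bit.exhaust)
  then have "finite {xs :: bit list. length xs = n}"
    using finite_lists_length_eq[of UNIV n] by simp
  moreover have "carrier_vec n \<subseteq> vec_of_list ` {xs :: bit list. length xs = n}"
    by (auto intro!: image_eqI[of _ _ "list_of_vec _"] simp: vec_list)
  ultimately show ?thesis
    by (rule finite_surj)
qed

subsection \<open>Splitting of the ambient space by an LCD code\<close>

text \<open>This is the nontrivial character of the additive group of the two-element field; integer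
  values let character sums count elements.\<close>

definition bit_sign :: "bit \<Rightarrow> int" where
  "bit_sign b = (if b = 0 then 1 else - 1)"

lemma bit_sign_add: "bit_sign (a + b) = bit_sign a * bit_sign b"
  by (cases a; cases b) (simp_all add: bit_sign_def)

text \<open>Orthogonality of characters: if \<open>z\<close> in \<open>S\<close> has
  \<open>x \<bullet> z \<noteq> 0\<close>, translation by \<open>z\<close> permutes \<open>S\<close>
  and flips every sign, so the sum equals its own negative.\<close>

lemma sum_bit_sign:
  assumes S: "binary_code n S" and x: "x \<in> carrier_vec n"
  shows "(\<Sum>y\<in>S. bit_sign (x \<bullet> y)) = (if \<forall>y\<in>S. x \<bullet> y = 0 then int (card S) else 0)"
proof (cases "\<forall>y\<in>S. x \<bullet> y = 0")
  case True
  then show ?thesis by (simp add: bit_sign_def)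
next
  case False
  then obtain z where z: "z \<in> S" "x \<bullet> z \<noteq> 0" by blast
  note S' = binary_codeD[OF S]
  have shift: "(y + z) + z = y" if "y \<in> S" for y
    using S'(1)[OF that] S'(1)[OF z(1)] by (simp add: assoc_add_vec[where n = n] bit_vec_add_self)
  have "(\<Sum>y\<in>S. bit_sign (x \<bullet> y)) = (\<Sum>y\<in>S. bit_sign (x \<bullet> (y + z)))"
    by (rule sum.reindex_bij_witness[of _ "\<lambda>y. y + z" "\<lambda>y. y + z"])
       (use shift S'(3) z in auto)
  also have "\<dots> = (\<Sum>y\<in>S. - bit_sign (x \<bullet> y))"
  proof (rule sum.cong)
    fix y assume "y \<in> S"
    then have "x \<bullet> (y + z) = x \<bullet> y + x \<bullet> z"
      using x S'(1) z by (intro scalar_prod_add_distrib[where n = n]) auto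
    then show "bit_sign (x \<bullet> (y + z)) = - bit_sign (x \<bullet> y)"
      using z by (simp only: bit_sign_add) (simp add: bit_sign_def)
  qed simp
  finally show ?thesis
    using False by (auto simp: sum_negf)
qed

lemma card_code_mult_card_dual:
  assumes C: "binary_code n C"
  shows "card C * card (dual_code n C) = card (carrier_vec n :: bit vec set)"
proof -
  let ?V = "carrier_vec n :: bit vec set"
  have sub: "C \<subseteq> ?V" and fin: "finite C"
    using C finite_subset[OF _ finite_carrier_vec_bit] by (auto simp: binary_code_iff)
  have V: "binary_code n ?V"
    by (simp add: binary_code_iff)
  \<comment> \<open>Nondegeneracy of the scalar product, tested on unit vectors; it leaves only the
    term \<open>c = 0\<close> once the sum over the whole space is taken first.\<close>
  have zero: "(\<forall>x\<in>?V. c \<bullet> x = 0) \<longleftrightarrow> c = 0\<^sub>v n" if "c \<in> ?V" for c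
  proof
    assume "\<forall>x\<in>?V. c \<bullet> x = 0"
    then have "c \<bullet> unit_vec n i = 0" if "i < n" for i by simp
    then show "c = 0\<^sub>v n"
      using \<open>c \<in> ?V\<close> by (intro eq_vecI) auto
  qed simp
  have dual: "{x \<in> ?V. \<forall>c\<in>C. x \<bullet> c = 0} = dual_code n C"
    by (auto simp: dual_code_iff)
  have "int (card C) * int (card (dual_code n C)) = (\<Sum>x\<in>?V. \<Sum>c\<in>C. bit_sign (x \<bullet> c))"
    using finite_carrier_vec_bit
    by (simp add: sum_bit_sign[OF C] flip: sum.inter_filter dual)
  also have "\<dots> = (\<Sum>c\<in>C. \<Sum>x\<in>?V. bit_sign (x \<bullet> c))"
    by (rule sum.swap)
  also have "\<dots> = (\<Sum>c\<in>C. \<Sum>x\<in>?V. bit_sign (c \<bullet> x))"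
    using sub by (intro sum.cong refl) (metis comm_scalar_prod subsetD)
  also have "\<dots> = (\<Sum>c\<in>C. if c = 0\<^sub>v n then int (card ?V) else 0)"
    using sub by (intro sum.cong refl) (simp add: sum_bit_sign[OF V] zero subsetD)
  also have "\<dots> = int (card ?V)"
    using fin binary_code_zero[OF C] by simp
  finally show ?thesis
    by (metis of_nat_eq_iff of_nat_mult)
qed

lemma lcd_Int:
  "lcd n C \<Longrightarrow> x \<in> C \<Longrightarrow> x \<in> dual_code n C \<Longrightarrow> x = 0\<^sub>v n"
  by (auto simp: lcd_def)

lemma lcd_decomposition:
  assumes C: "binary_code n C" and "lcd n C" and x: "x \<in> carrier_vec n"
  obtains c d where "c \<in> C" "d \<in> dual_code n C" "x = c + d"
proof -
  let ?D = "dual_code n C" and ?V = "carrier_vec n :: bit vec set"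
  note C' = binary_codeD[OF C] and D' = binary_codeD[OF binary_code_dual[OF C]]
  \<comment> \<open>Addition on \<open>C \<times> ?D\<close> is injective by the LCD property; since
    both sides have the same finite size, it is onto.\<close>
  have "inj_on (\<lambda>(c, d). c + d) (C \<times> ?D)"
  proof (rule inj_onI, clarify)
    fix c d c' d'
    assume *: "c \<in> C" "d \<in> ?D" "c' \<in> C" "d' \<in> ?D" "c + d = c' + d'"
    note car = C'(1)[OF *(1)] D'(1)[OF *(2)] C'(1)[OF *(3)] D'(1)[OF *(4)]
    have "(c + c') + (d + d') = (c + d) + (c' + d')"
      using car by (intro eq_vecI) auto
    then have "(c + c') + (d + d') = 0\<^sub>v n"
      unfolding *(5) using car by (simp add: bit_vec_add_self[where n = n] del: assoc_add_vec)
    \<comment> \<open>In characteristic 2 sums are differences, so this vector lies both in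
      \<open>C\<close> and in its dual.\<close>
    then have eq: "c + c' = d + d'"
      by (rule iffD1[OF bit_vec_add_eq_zero_iff, rotated 2]) (use car in auto)
    have "c + c' = 0\<^sub>v n"
      using lcd_Int[OF \<open>lcd n C\<close> C'(3)[OF *(1,3)]] D'(3)[OF *(2,4)] eq by simp
    then show "c = c' \<and> d = d'"
      using bit_vec_add_eq_zero_iff[OF car(1,3)] bit_vec_add_eq_zero_iff[OF car(2,4)] eq by simp
  qed
  then have "card ((\<lambda>(c, d). c + d) ` (C \<times> ?D)) = card ?V"
    by (simp add: card_image card_cartesian_product card_code_mult_card_dual[OF C])
  moreover have "(\<lambda>(c, d). c + d) ` (C \<times> ?D) \<subseteq> ?V"
    by (auto intro!: add_carrier_vec dest: C'(1) D'(1))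
  ultimately have "(\<lambda>(c, d). c + d) ` (C \<times> ?D) = ?V"
    by (intro card_subset_eq finite_carrier_vec_bit)
  then show ?thesis
    using x that by (auto simp: image_iff set_eq_iff)
qed

subsection \<open>Orthogonal projectors\<close>

text \<open>Transposition turns the action on row vectors from the right into ordinary matrix-vector
  multiplication, in which all later arguments are phrased.\<close>

lemma mat_of_row_mult_eq_iff:
  fixes P :: "'a::comm_semiring_0 mat"
  assumes "P \<in> carrier_mat m n" "v \<in> carrier_vec m" "w \<in> carrier_vec n"
  shows "mat_of_row v * P = mat_of_row w \<longleftrightarrow> P\<^sup>T *\<^sub>v v = w"
proof -
  have *: "mat_of_row v * P = mat_of_row (P\<^sup>T *\<^sub>v v)"
  proof (rule eq_matI)
    fix i j assume "i < dim_row (mat_of_row (P\<^sup>T *\<^sub>v v))" "j < dim_col (mat_of_row (P\<^sup>T *\<^sub>v v))"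
    then have "i = 0" "j < n"
      using assms by auto
    then show "(mat_of_row v * P) $$ (i, j) = mat_of_row (P\<^sup>T *\<^sub>v v) $$ (i, j)"
      using assms by (simp add: comm_scalar_prod[where n = m])
  qed (use assms in auto)
  show ?thesis
    unfolding * by (metis row_mat_of_row)
qed

text \<open>A predicate in place of the definite description allows existence and uniqueness to be
  shown separately.\<close>

definition projects_onto :: "nat \<Rightarrow> bit vec set \<Rightarrow> bit mat \<Rightarrow> bool" where
  "projects_onto n C P \<longleftrightarrow>
     P \<in> carrier_mat n n \<and> (\<forall>v\<in>C. P\<^sup>T *\<^sub>v v = v) \<and> (\<forall>v\<in>dual_code n C. P\<^sup>T *\<^sub>v v = 0\<^sub>v n)"

lemma orthogonal_projector_eq:
  assumes "binary_code n C"
  shows "orthogonal_projector n C = (THE P. projects_onto n C P)"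
proof -
  have zero: "0\<^sub>m 1 n = mat_of_row (0\<^sub>v n :: bit vec)"
    by (intro eq_matI) (auto simp: mat_of_row_def)
  have "(P \<in> carrier_mat n n \<and> (\<forall>v\<in>C. mat_of_row v * P = mat_of_row v) \<and>
      (\<forall>v\<in>dual_code n C. mat_of_row v * P = 0\<^sub>m 1 n)) \<longleftrightarrow> projects_onto n C P" for P
    using binary_code_carrier[OF assms] unfolding projects_onto_def zero
    by (auto simp: mat_of_row_mult_eq_iff[where m = n and n = n] dual_code_iff)
  then show ?thesis
    by (simp add: orthogonal_projector_def)
qed

text \<open>Both transposes act alike on \<open>C\<close> and on its dual, hence on every vector by
  the decomposition; unit vectors then compare the entries.\<close>

lemma projects_onto_unique:
  assumes C: "binary_code n C" and lcd: "lcd n C"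
    and P: "projects_onto n C P" and Q: "projects_onto n C Q"
  shows "P = Q"
proof -
  have car [simp]: "P \<in> carrier_mat n n" "Q \<in> carrier_mat n n"
    using P Q by (auto simp: projects_onto_def)
  have apply_eq: "P\<^sup>T *\<^sub>v x = Q\<^sup>T *\<^sub>v x" if x: "x \<in> carrier_vec n" for x
  proof -
    obtain c d where cd: "c \<in> C" "d \<in> dual_code n C" "x = c + d"
      using lcd_decomposition[OF C lcd x] by blast
    have "c \<in> carrier_vec n" "d \<in> carrier_vec n"
      using cd binary_code_carrier[OF C] by (auto simp: dual_code_iff)
    then show ?thesis
      using P Q cd by (simp add: projects_onto_def mult_add_distrib_mat_vec[where nr = n and nc = n])
  qed
  have "P\<^sup>T = Q\<^sup>T"
  proof (rule eq_matI)
    fix i j assume ij: "i < dim_row Q\<^sup>T" "j < dim_col Q\<^sup>T"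
    then have lt: "i < n" "j < n"
      using car by auto
    have "(P\<^sup>T *\<^sub>v unit_vec n j) $ i = (Q\<^sup>T *\<^sub>v unit_vec n j) $ i"
      using apply_eq by simp
    then show "P\<^sup>T $$ (i, j) = Q\<^sup>T $$ (i, j)"
      using lt carrier_matD[OF car(1)] carrier_matD[OF car(2)]
      by simp
  qed (use carrier_matD[OF car(1)] carrier_matD[OF car(2)] in auto)
  then show ?thesis
    using transpose_transpose by metis
qed

text \<open>Each unit vector is split into a part in \<open>C\<close> and a part in the dual. The
  first parts are the columns of \<open>M\<close>, the second those of \<open>N\<close>, so
  \<open>M\<close> and \<open>N\<close> are the two complementary projections.\<close>

lemma projects_onto_exists:
  assumes C: "binary_code n C" and lcd: "lcd n C"
  shows "\<exists>P. projects_onto n C P"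
proof -
  let ?D = "dual_code n C"
  note D = binary_code_dual[OF C]
  note C' = binary_codeD[OF C] and D' = binary_codeD[OF D]
  \<comment> \<open>No bound on \<open>i\<close> is required: for \<open>i \<ge> n\<close> the
    vector \<open>unit_vec n i\<close> is the zero vector of length \<open>n\<close>.\<close>
  have "\<forall>i. \<exists>c d. c \<in> C \<and> d \<in> ?D \<and> unit_vec n i = c + d"
    using lcd_decomposition[OF C lcd unit_vec_carrier] by metis
  then obtain c d where cd: "\<And>i. c i \<in> C" "\<And>i. d i \<in> ?D" "\<And>i. unit_vec n i = c i + d i"
    by metis
  have [simp]: "dim_vec (c i) = n" "dim_vec (d i) = n" for i
    using cd C'(1) D'(1) by (metis carrier_vecD)+
  define M where "M = mat n n (\<lambda>(i, j). c j $ i)"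
  define N where "N = mat n n (\<lambda>(i, j). d j $ i)"
  have car: "M \<in> carrier_mat n n" "N \<in> carrier_mat n n"
    by (auto simp: M_def N_def)
  have "col M j = c j" "col N j = d j" if "j < n" for j
    using that by (auto simp: M_def N_def)
  then have in_C: "M *\<^sub>v v \<in> C" and in_D: "N *\<^sub>v v \<in> ?D" if "v \<in> carrier_vec n" for v
    using binary_code_mult_mat_vec[OF C car(1) _ that]
      binary_code_mult_mat_vec[OF D car(2) _ that] cd by auto
  have one: "M + N = 1\<^sub>m n"
  proof (rule eq_matI)
    fix i j assume "i < dim_row (1\<^sub>m n)" "j < dim_col (1\<^sub>m n)"
    then have "i < n" "j < n" by auto
    then show "(M + N) $$ (i, j) = 1\<^sub>m n $$ (i, j)"
      using arg_cong[OF cd(3)[of j], of "\<lambda>v. v $ i"] by (simp add: M_def N_def)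
  qed (auto simp: M_def N_def)
  have split: "M *\<^sub>v v + N *\<^sub>v v = v" if "v \<in> carrier_vec n" for v
    using add_mult_distrib_mat_vec[OF car that] one that by simp
  have "M *\<^sub>v v = v" if v: "v \<in> C" for v
  proof -
    note vn = C'(1)[OF v]
    have Mn: "M *\<^sub>v v \<in> carrier_vec n" "N *\<^sub>v v \<in> carrier_vec n"
      using in_C[OF vn] in_D[OF vn] C'(1) D'(1) by auto
    \<comment> \<open>Adding \<open>M *\<^sub>v v\<close> twice changes nothing, so
      \<open>N *\<^sub>v v\<close> is a sum of two words of \<open>C\<close>; it also lies in the
      dual and must vanish.\<close>
    have "N *\<^sub>v v = M *\<^sub>v v + (M *\<^sub>v v + N *\<^sub>v v)"
      using Mn by (simp add: bit_vec_add_self flip: assoc_add_vec)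
    also have "\<dots> = M *\<^sub>v v + v"
      by (simp add: split[OF vn])
    finally have "N *\<^sub>v v \<in> C"
      using C'(3) in_C[OF vn] v by auto
    then have "N *\<^sub>v v = 0\<^sub>v n"
      using lcd_Int[OF lcd] in_D[OF vn] by blast
    then show ?thesis
      using split[OF vn] Mn by simp
  qed
  moreover have "M *\<^sub>v v = 0\<^sub>v n" if v: "v \<in> ?D" for v
  proof -
    note vn = D'(1)[OF v]
    have Mn: "M *\<^sub>v v \<in> carrier_vec n" "N *\<^sub>v v \<in> carrier_vec n"
      using in_C[OF vn] in_D[OF vn] C'(1) D'(1) by auto
    have "M *\<^sub>v v = (M *\<^sub>v v + N *\<^sub>v v) + N *\<^sub>v v"
      using Mn by (simp add: bit_vec_add_self assoc_add_vec[where n = n])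
    also have "\<dots> = v + N *\<^sub>v v"
      by (simp add: split[OF vn])
    finally have "M *\<^sub>v v \<in> ?D"
      using D'(3) in_D[OF vn] v by auto
    then show ?thesis
      using lcd_Int[OF lcd] in_C[OF vn] by blast
  qed
  ultimately have "projects_onto n C M\<^sup>T"
    using car by (simp add: projects_onto_def)
  then show ?thesis ..
qed

lemma orthogonal_projector_eq_iff:
  assumes "binary_code n C" "lcd n C"
  shows "orthogonal_projector n C = P \<longleftrightarrow> projects_onto n C P"
  using projects_onto_exists[OF assms] projects_onto_unique[OF assms]
  unfolding orthogonal_projector_eq[OF assms(1)] by (metis theI)

text \<open>Applying the projector twice has the same effect on \<open>C\<close> and on its dual, so
  uniqueness identifies \<open>P * P\<close> with \<open>P\<close>.\<close>

lemma projects_onto_idempotent: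
  assumes C: "binary_code n C" and lcd: "lcd n C" and P: "projects_onto n C P"
  shows "P * P = P"
proof -
  have Pn: "P \<in> carrier_mat n n"
    using P by (simp add: projects_onto_def)
  have "projects_onto n C (P * P)"
    using P binary_code_carrier[OF C] Pn unfolding projects_onto_def
    by (auto simp: transpose_mult[OF Pn Pn] dual_code_iff)
  then show ?thesis
    using projects_onto_unique[OF C lcd] P by blast
qed

subsection \<open>Symmetric idempotent matrices\<close>

text \<open>Pairing with the all-ones vector makes evenness of weight a linear condition.\<close>

lemma scalar_prod_ones:
  assumes "v \<in> carrier_vec n"
  shows "v \<bullet> vec n (\<lambda>_. 1) = of_bool (odd (hamming_weight v))"
proof -
  have "v \<bullet> vec n (\<lambda>_. 1) = (\<Sum>i\<in>{0..<n}. if v $ i \<noteq> 0 then 1 else 0)"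
    unfolding scalar_prod_def by (intro sum.cong) auto
  also have "\<dots> = of_bool (odd (card {i \<in> {0..<n}. v $ i \<noteq> 0}))"
    by (rule sum_bit_indicator) simp
  also have "{i \<in> {0..<n}. v $ i \<noteq> 0} = {i. i < dim_vec v \<and> v $ i \<noteq> 0}"
    using assms by auto
  finally show ?thesis
    by (simp add: hamming_weight_def)
qed

lemma even_code_iff:
  assumes "C \<subseteq> carrier_vec n"
  shows "even_code C \<longleftrightarrow> (\<forall>v\<in>C. v \<bullet> vec n (\<lambda>_. 1) = 0)"
  unfolding even_code_def using assms by (intro ball_cong) (auto simp: scalar_prod_ones)

lemma symmetric_idempotent_is_projector:
  fixes A :: "bit mat"
  assumes A: "A \<in> carrier_mat n n" and sym: "A\<^sup>T = A" and idem: "A * A = A"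
    and sums: "A *\<^sub>v vec n (\<lambda>_. 1) = 0\<^sub>v n"
  shows "\<exists>C. binary_code n C \<and> lcd n C \<and> even_code C \<and> A = orthogonal_projector n C"
proof -
  define C where "C = (\<lambda>x. A *\<^sub>v x) ` carrier_vec n"
  have code: "binary_code n C"
    unfolding binary_code_iff C_def
  proof (intro conjI ballI; (elim imageE)?)
    show "0\<^sub>v n \<in> (\<lambda>x. A *\<^sub>v x) ` carrier_vec n"
      using A by (intro image_eqI[of _ _ "0\<^sub>v n"]) auto
    fix x y u v
    assume "x = A *\<^sub>v u" "u \<in> carrier_vec n" "y = A *\<^sub>v v" "v \<in> carrier_vec n"
    then show "x + y \<in> (\<lambda>x. A *\<^sub>v x) ` carrier_vec n"
      using A by (intro image_eqI[of _ _ "u + v"]) (auto simp: mult_add_distrib_mat_vec[where nr = n and nc = n])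
  qed (use A in auto)
  have adjoint: "(A *\<^sub>v x) \<bullet> y = x \<bullet> (A *\<^sub>v y)" if "x \<in> carrier_vec n" "y \<in> carrier_vec n" for x y
    using transpose_vec_mult_scalar[OF A that(2,1)] sym that A
    by (metis comm_scalar_prod mult_mat_vec_carrier)
  have fixed: "A *\<^sub>v v = v" if "v \<in> C" for v
    using that A idem by (auto simp: C_def simp flip: assoc_mult_mat_vec)
  \<comment> \<open>Self-adjointness moves \<open>A\<close> onto the unit vector; its image is a
    word of \<open>C\<close>, to which \<open>v\<close> is orthogonal.\<close>
  have kernel: "A *\<^sub>v v = 0\<^sub>v n" if v: "v \<in> dual_code n C" for v
  proof (rule eq_vecI)
    fix i assume "i < dim_vec (0\<^sub>v n)"
    then have i: "i < n" by simp
    have "(A *\<^sub>v v) $ i = (A *\<^sub>v v) \<bullet> unit_vec n i"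
      using i A by simp
    also have "\<dots> = v \<bullet> (A *\<^sub>v unit_vec n i)"
      using v by (intro adjoint) (auto simp: dual_code_iff)
    also have "\<dots> = 0"
      using v by (auto simp: dual_code_iff C_def)
    finally show "(A *\<^sub>v v) $ i = 0\<^sub>v n $ i"
      using i by simp
  qed (use A in simp)
  \<comment> \<open>A word in both \<open>C\<close> and its dual is fixed by \<open>A\<close> and
    also sent to zero.\<close>
  have lcd: "lcd n C"
    using fixed kernel binary_code_zero[OF code] binary_code_zero[OF binary_code_dual[OF code]]
    by (fastforce simp: lcd_def)
  \<comment> \<open>For \<open>v = A *\<^sub>v x\<close>, self-adjointness moves \<open>A\<close>
    onto the all-ones vector, which \<open>sums\<close> sends to zero.\<close>
  have "v \<bullet> vec n (\<lambda>_. 1) = 0" if "v \<in> C" for v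
    using that sums by (auto simp: C_def adjoint)
  then have "even_code C"
    using code by (simp add: even_code_iff[of _ n] binary_code_iff)
  moreover have "projects_onto n C A"
    using A sym fixed kernel by (simp add: projects_onto_def)
  ultimately show ?thesis
    using code lcd orthogonal_projector_eq_iff by metis
qed

subsection \<open>Adjacency matrices\<close>

lemma adjacency_matrix_simps [simp]:
  "adjacency_matrix n E \<in> carrier_mat n n"
  "dim_row (adjacency_matrix n E) = n"
  "dim_col (adjacency_matrix n E) = n"
  "i < n \<Longrightarrow> j < n \<Longrightarrow> adjacency_matrix n E $$ (i, j) = of_bool ({i, j} \<in> E)"
  by (simp_all add: adjacency_matrix_def)

lemma transpose_adjacency_matrix: "(adjacency_matrix n E)\<^sup>T = adjacency_matrix n E"
  by (intro eq_matI) (auto simp: insert_commute)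

lemma neighbours_subset:
  assumes "simple_graph n E"
  shows "neighbours E v \<subseteq> {..<n}"
  using assms by (auto simp: simple_graph_def neighbours_def)

lemma simple_graph_loopless:
  assumes "simple_graph n E"
  shows "{v, v} \<notin> E"
  using assms by (force simp: simple_graph_def)

lemma adjacency_matrix_square:
  assumes "simple_graph n E" "u < n" "v < n"
  shows "(adjacency_matrix n E * adjacency_matrix n E :: bit mat) $$ (u, v) =
    of_bool (odd (card (neighbours E u \<inter> neighbours E v)))"
proof -
  have "(adjacency_matrix n E * adjacency_matrix n E :: bit mat) $$ (u, v) =
      row (adjacency_matrix n E) u \<bullet> col (adjacency_matrix n E) v"
    using assms by simp
  also have "\<dots> = (\<Sum>w\<in>{0..<n}. if {u, w} \<in> E \<and> {v, w} \<in> E then 1 else 0)"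
    unfolding scalar_prod_def using assms by (intro sum.cong) (auto simp: insert_commute)
  also have "\<dots> = of_bool (odd (card {w \<in> {0..<n}. {u, w} \<in> E \<and> {v, w} \<in> E}))"
    by (rule sum_bit_indicator) simp
  \<comment> \<open>\<open>neighbours\<close> carries no bound on vertices; it comes from the edges
    of a simple graph lying within \<open>{..<n}\<close>.\<close>
  also have "{w \<in> {0..<n}. {u, w} \<in> E \<and> {v, w} \<in> E} = neighbours E u \<inter> neighbours E v"
    using neighbours_subset[OF assms(1)] by (auto simp: neighbours_def)
  finally show ?thesis
    .
qed

lemma adjacency_matrix_idempotent_iff:
  assumes E: "simple_graph n E"
  shows "adjacency_matrix n E * adjacency_matrix n E = (adjacency_matrix n E :: bit mat) \<longleftrightarrow>
    (\<forall>v<n. even (vertex_degree E v)) \<and>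
    (\<forall>u<n. \<forall>v<n. {u, v} \<in> E \<longrightarrow> odd (card (neighbours E u \<inter> neighbours E v))) \<and>
    (\<forall>u<n. \<forall>v<n. u \<noteq> v \<and> {u, v} \<notin> E \<longrightarrow> even (card (neighbours E u \<inter> neighbours E v)))"
    (is "?L \<longleftrightarrow> ?R")
proof -
  have "?L \<longleftrightarrow> (\<forall>u<n. \<forall>v<n. odd (card (neighbours E u \<inter> neighbours E v)) \<longleftrightarrow> {u, v} \<in> E)"
    by (auto simp: mat_eq_iff adjacency_matrix_square[OF E] simp del: index_mult_mat(1))
  also have "\<dots> \<longleftrightarrow> ?R"
  proof (rule iffI; intro conjI allI impI)
    fix u v assume "?R" "u < n" "v < n"
    then show "odd (card (neighbours E u \<inter> neighbours E v)) \<longleftrightarrow> {u, v} \<in> E"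
      \<comment> \<open>The diagonal entries encode the degree condition: a vertex shares all its
        neighbours with itself, and the absence of loops makes the diagonal of the adjacency matrix
        zero.\<close>
      using simple_graph_loopless[OF E] by (cases "u = v") (auto simp: vertex_degree_def)
  next
    fix v assume "\<forall>u<n. \<forall>v<n. odd (card (neighbours E u \<inter> neighbours E v)) \<longleftrightarrow> {u, v} \<in> E" "v < n"
    then show "even (vertex_degree E v)"
      using simple_graph_loopless[OF E, of v] by (metis Int_absorb vertex_degree_def)
  qed auto
  finally show ?thesis .
qed

lemma adjacency_matrix_row_sum:
  assumes "simple_graph n E" "v < n"
  shows "(adjacency_matrix n E *\<^sub>v vec n (\<lambda>_. 1) :: bit vec) $ v = of_bool (odd (vertex_degree E v))"
proof -
  have "(adjacency_matrix n E *\<^sub>v vec n (\<lambda>_. 1) :: bit vec) $ v =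
      row (adjacency_matrix n E) v \<bullet> vec n (\<lambda>_. 1)"
    using assms by simp
  also have "\<dots> = (\<Sum>w\<in>{0..<n}. if {v, w} \<in> E then 1 else 0)"
    unfolding scalar_prod_def using assms by (intro sum.cong) auto
  also have "\<dots> = of_bool (odd (card {w \<in> {0..<n}. {v, w} \<in> E}))"
    by (rule sum_bit_indicator) simp
  also have "{w \<in> {0..<n}. {v, w} \<in> E} = neighbours E v"
    using neighbours_subset[OF assms(1)] by (auto simp: neighbours_def)
  finally show ?thesis
    by (simp add: vertex_degree_def)
qed

theorem corollary3p3:
  fixes n :: nat and E :: "nat set set"
  assumes "simple_graph n E"
  shows "yields_even_lcd_code n E \<longleftrightarrow>
    (\<forall>v<n. even (vertex_degree E v)) \<and>
    (\<forall>u<n. \<forall>v<n. {u, v} \<in> E \<longrightarrow> odd (card (neighbours E u \<inter> neighbours E v))) \<and>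
    (\<forall>u<n. \<forall>v<n. u \<noteq> v \<and> {u, v} \<notin> E \<longrightarrow> even (card (neighbours E u \<inter> neighbours E v)))"
    (is "_ \<longleftrightarrow> ?R")
proof
  assume "yields_even_lcd_code n E"
  then obtain C where "binary_code n C" "lcd n C" "projects_onto n C (adjacency_matrix n E)"
    unfolding yields_even_lcd_code_def using orthogonal_projector_eq_iff by metis
  then show ?R
    using projects_onto_idempotent adjacency_matrix_idempotent_iff[OF assms] by blast
next
  assume R: ?R
  \<comment> \<open>Even degrees place the all-ones vector in the kernel, which is what makes the
    constructed code even.\<close>
  then have "adjacency_matrix n E *\<^sub>v vec n (\<lambda>_. 1) = (0\<^sub>v n :: bit vec)"
    by (intro eq_vecI)
      (auto simp: adjacency_matrix_row_sum[OF assms] simp del: index_mult_mat_vec)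
  then show "yields_even_lcd_code n E"
    unfolding yields_even_lcd_code_def
    using R adjacency_matrix_idempotent_iff[OF assms]
    by (intro symmetric_idempotent_is_projector) (simp_all add: transpose_adjacency_matrix)
qed

end
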